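(* Let $K\ge2$ and $T_K=\log K+\log\log K+1$. For $\mathbf p\in[0,1]^K$ define, with $\inf\varnothing=1$, $$F_{\mathrm{EH}}(\mathbf p)=\inf\left\{\alpha\in(0,1):\ \bigvee_{\ell\le K}\left(\frac1\ell\sum_{i=1}^\ell\left(\frac{\alpha}{T_Kp_i}-\frac1{T_K}\right)_+\right)\ge1\right\},$$ $$F'_{\mathrm{EH}}(\mathbf p)=\inf\left\{\alpha\in(0,1):\ \bigvee_{\ell\le K}\left(\frac1\ell\sum_{i=1}^\ell\left(\frac{\alpha}{T_Kp_i}-\frac1{T_K}\right)\right)\ge1\right\},\qquad F'_{\mathrm H}(\mathbf p)=(T_K+1)H(\mathbf p).$$ Then $F_{\mathrm{EH}},F'_{\mathrm{EH}},F'_{\mathrm H}$ are ex-p-merging functions, $F_{\mathrm{EH}}\le F'_{\mathrm{EH}}\le F'_{\mathrm H}$ on $[0,1]^K$, and both of these dominations are strict. Moreover, for all $\mathbf p\in[0,1]^K$, $$F'_{\mathrm{EH}}(\mathbf p)=\min\left\{1,\ \bigwedge_{m=1}^K(T_K+1)H(\mathbf p_m)\right\},\qquad F_{\mathrm{EH}}(\mathbf p)=\min\left\{1,\ \bigwedge_{\ell=1}^K\bigwedge_{m=1}^\ell\left(\frac{\ell\,T_K}m+1\right)H(\mathbf p^\ell_{(m)})\right\}.$$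
   Context: $\bigvee,\bigwedge$ denote maximum and minimum; $x_+=\max(x,0)$; $\alpha/0=\infty$. $H(\mathbf q)=n\left(\sum_{i=1}^n1/q_i\right)^{-1}$ is the harmonic mean of a vector $\mathbf q$ with $n$ components (equal to $0$ if some $q_i=0$); $\mathbf p_m=(p_1,\dots,p_m)$; $\mathbf p^\ell_{(m)}$ is the vector of the $m$ smallest elements of $(p_1,\dots,p_\ell)$. Fix an atomless probability space; $\mathcal U^K$ is the set of all $K$-dimensional random vectors (arbitrary joint distribution) with components uniform on $[0,1]$; a vector is exchangeable if its law is invariant under permutations of components. An ex-p-merging function is an increasing (non-decreasing in each component) Borel function $F:[0,1]^K\to[0,\infty)$ with $\mathbb P(F(\mathbf P)\le\alpha)\le\alpha$ for all $\alpha\in(0,1)$ and all exchangeable $\mathbf P\in\mathcal U^K$. A domination $F\le G$ is strict if $F(\mathbf p)<G(\mathbf p)$ for at least one $\mathbf p$. *)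

theory Defs
  imports "HOL-Probability.Probability" "HOL-Combinatorics.Permutations"
begin

text \<open>Vectors with \<open>K\<close> components are functions on the index set \<open>{1..K}\<close>, as used by
  \<open>PiE\<close> and \<open>PiM\<close>.\<close>

definition cube :: "nat \<Rightarrow> (nat \<Rightarrow> real) set" where
  "cube K = ({1..K} \<rightarrow>\<^sub>E {0..1})"

definition atomless :: "'a measure \<Rightarrow> bool" where
  "atomless M \<longleftrightarrow>
     (\<forall>A\<in>sets M. measure M A > 0 \<longrightarrow>
        (\<exists>B\<in>sets M. B \<subseteq> A \<and> 0 < measure M B \<and> measure M B < measure M A))"

definition uniform_vectors :: "'a measure \<Rightarrow> nat \<Rightarrow> ('a \<Rightarrow> nat \<Rightarrow> real) set" where
  "uniform_vectors M K =
     {P \<in> M \<rightarrow>\<^sub>M (\<Pi>\<^sub>M i\<in>{1..K}. borel).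
        \<forall>i\<in>{1..K}. distr M borel (\<lambda>\<omega>. P \<omega> i) = uniform_measure lborel {0..1}}"

definition exchangeable :: "'a measure \<Rightarrow> nat \<Rightarrow> ('a \<Rightarrow> nat \<Rightarrow> real) \<Rightarrow> bool" where
  "exchangeable M K P \<longleftrightarrow>
     (\<forall>\<sigma>. \<sigma> permutes {1..K} \<longrightarrow>
        distr M (\<Pi>\<^sub>M i\<in>{1..K}. borel) (\<lambda>\<omega>. \<lambda>i\<in>{1..K}. P \<omega> (\<sigma> i))
          = distr M (\<Pi>\<^sub>M i\<in>{1..K}. borel) P)"

text \<open>A function on \<open>[0,1]\<^sup>K\<close> is a total function whose values off \<open>cube K\<close> are irrelevant.
  A vector with uniform components may leave the cube on a null set; hence the condition
  \<open>P \<omega> \<in> cube K\<close> in the event, which makes \<open>F (P \<omega>)\<close> meaningful and does not change its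
  probability.\<close>

definition ex_p_merging :: "'a measure \<Rightarrow> nat \<Rightarrow> ((nat \<Rightarrow> real) \<Rightarrow> real) \<Rightarrow> bool" where
  "ex_p_merging M K F \<longleftrightarrow>
     F \<in> borel_measurable (restrict_space (\<Pi>\<^sub>M i\<in>{1..K}. borel) (cube K)) \<and>
     (\<forall>p\<in>cube K. 0 \<le> F p) \<and>
     (\<forall>p\<in>cube K. \<forall>q\<in>cube K. (\<forall>i\<in>{1..K}. p i \<le> q i) \<longrightarrow> F p \<le> F q) \<and>
     (\<forall>P\<in>uniform_vectors M K. exchangeable M K P \<longrightarrow>
        (\<forall>\<alpha>\<in>{0<..<1}. measure M {\<omega>\<in>space M. P \<omega> \<in> cube K \<and> F (P \<omega>) \<le> \<alpha>} \<le> \<alpha>))"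

definition strictly_dominates ::
    "nat \<Rightarrow> ((nat \<Rightarrow> real) \<Rightarrow> real) \<Rightarrow> ((nat \<Rightarrow> real) \<Rightarrow> real) \<Rightarrow> bool" where
  "strictly_dominates K F G \<longleftrightarrow> (\<forall>p\<in>cube K. F p \<le> G p) \<and> (\<exists>p\<in>cube K. F p < G p)"

definition harmonic_mean :: "real list \<Rightarrow> real" where
  "harmonic_mean q =
     (if 0 \<in> set q then 0 else real (length q) * inverse (\<Sum>x\<leftarrow>q. 1 / x))"

definition initial_vec :: "(nat \<Rightarrow> real) \<Rightarrow> nat \<Rightarrow> real list" where
  "initial_vec p m = map p [1..<Suc m]"

definition smallest_vec :: "(nat \<Rightarrow> real) \<Rightarrow> nat \<Rightarrow> nat \<Rightarrow> real list" where
  "smallest_vec p l m = take m (sort (initial_vec p l))"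

definition T :: "nat \<Rightarrow> real" where
  "T K = ln (real K) + ln (ln (real K)) + 1"

text \<open>The terms \<open>\<alpha> / (T K * p i)\<close> are computed in \<^typ>\<open>ereal\<close>, where \<open>c / 0 = \<infinity>\<close> for \<open>c > 0\<close>.
  The value \<open>1\<close> for an empty set has to be stated explicitly, since \<^term>\<open>Inf {} :: real\<close>
  is not \<open>1\<close>.\<close>

definition F_EH :: "nat \<Rightarrow> (nat \<Rightarrow> real) \<Rightarrow> real" where
  "F_EH K p =
     (let S = {\<alpha>\<in>{0<..<1::real}.
            (MAX l\<in>{1..K}. ereal (1 / real l) *
               (\<Sum>i=1..l. max (ereal \<alpha> / ereal (T K * p i) - ereal (1 / T K)) 0)) \<ge> 1}
      in if S = {} then 1 else Inf S)"

definition F'_EH :: "nat \<Rightarrow> (nat \<Rightarrow> real) \<Rightarrow> real" where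
  "F'_EH K p =
     (let S = {\<alpha>\<in>{0<..<1::real}.
            (MAX l\<in>{1..K}. ereal (1 / real l) *
               (\<Sum>i=1..l. ereal \<alpha> / ereal (T K * p i) - ereal (1 / T K))) \<ge> 1}
      in if S = {} then 1 else Inf S)"

definition F'_H :: "nat \<Rightarrow> (nat \<Rightarrow> real) \<Rightarrow> real" where
  "F'_H K p = (T K + 1) * harmonic_mean (initial_vec p K)"

end

theory Submission
  imports Defs
begin

text \<open>An exchangeable maximal inequality bounds the probability that some average of the first \<open>l\<close>
  of \<open>K\<close> exchangeable nonnegative variables is at least 1 by their common expectation. It is applied
  to the values at \<open>P\<^sub>i\<close> of the function \<open>(\<alpha> / p - 1)\<^sub>+ / T\<close> truncated at \<open>K\<close>, whose integral over
  \<open>[0,1]\<close> is \<open>\<alpha> ln (K T + 1) / T \<le> \<alpha>\<close>; this is where the value of \<open>T\<close> comes from.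
  For the closed forms, a sum of positive parts is the largest partial sum over the smallest
  entries, and \<open>(\<Sum>i\<le>m. \<alpha> / p\<^sub>i - 1) / T \<ge> l\<close> means that \<open>\<alpha>\<close> is at least \<open>(l T / m + 1)\<close> times the
  harmonic mean. Strictness is witnessed by \<open>(1, a, 1, \<dots>, 1)\<close> with \<open>a = 1 / (4 T + 2)\<close> and by
  \<open>(1, \<dots>, 1)\<close>.\<close>

subsection \<open>The constant \<open>T\<close>\<close>

text \<open>The term \<open>ln (ln K)\<close> is negative for \<open>K = 2\<close>. With
  \<open>x = ln K \<ge> 2/3\<close> the bound \<open>ln x \<ge> 1 - 1/x \<ge> -1/2\<close> keeps
  this loss below \<open>x\<close>.\<close>

lemma T_gt_1:
  assumes "K \<ge> 2"
  shows "T K > 1"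
proof -
  define x where "x = ln (real K)"
  have "ln 2 \<le> x" using assms by (simp add: x_def)
  hence x: "x \<ge> 2/3" using ln2_ge_two_thirds by linarith
  have "ln (1/x) \<le> 1/x - 1" using x by (intro ln_le_minus_one) auto
  hence "ln x \<ge> 1 - 1/x" using x by (simp add: ln_div)
  moreover have "1/x \<le> 3/2" using x by (simp add: field_simps)
  ultimately have "x + ln x + 1 > 1" using x by linarith
  thus ?thesis by (simp add: T_def x_def)
qed

text \<open>Writing \<open>x = ln K\<close>, the claim follows from \<open>x + ln x + 3/2 \<le> exp 1 * x\<close>. The tangent
  of \<open>ln\<close> at \<open>1 / (exp 1 - 1)\<close> reduces this to \<open>exp 1 \<le> (exp 1 - 1)\<^sup>2\<close>.\<close>

lemma ln_K_T_le_T: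
  assumes "K \<ge> 2"
  shows "ln (real K * T K + 1) \<le> T K"
proof -
  define x where "x = ln (real K)"
  have x: "x > 0" using assms by (simp add: x_def)
  have e: "exp 1 \<ge> (2.7::real)"
    using e_approx_32 by (simp add: abs_if split: if_split_asm)
  define c where "c = exp 1 - (1::real)"
  have c: "c \<ge> 1.7" using e by (simp add: c_def)
  \<comment> \<open>Since 1.7 * 0.7 = 1.19 exceeds 1, this gives
    \<open>c * c \<ge> c + 1 = exp 1\<close>.\<close>
  have "c * (c - 1) \<ge> 1.7 * 0.7" using c by (intro mult_mono) auto
  hence "c\<^sup>2 \<ge> exp 1" by (simp add: c_def power2_eq_square algebra_simps)
  hence "ln (exp 1) \<le> ln (c\<^sup>2)" using c by (subst ln_le_cancel_iff) auto
  hence lc: "ln c \<ge> 1/2" using c by (simp add: ln_realpow)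
  have "ln (c * x) \<le> c * x - 1" using c x by (intro ln_le_minus_one) auto
  hence lx: "ln x \<le> c * x - 3/2" using c x lc by (simp add: ln_mult)
  have "real K * (T K) = real K * (x + ln x + 1)" by (simp add: T_def x_def)
  also have "\<dots> \<le> real K * (exp 1 * x - 1/2)"
    using lx by (intro mult_left_mono) (auto simp: c_def algebra_simps)
  also have "\<dots> = exp 1 * real K * x - real K / 2" by (simp add: algebra_simps)
  \<comment> \<open>The slack \<open>K / 2\<close> is at least 1 and absorbs the 1 inside the
    logarithm of the claim.\<close>
  also have "\<dots> \<le> exp 1 * real K * x - 1" using assms by simp
  finally have "real K * T K + 1 \<le> exp 1 * real K * x" by simp
  moreover have "real K * T K + 1 > 0" using T_gt_1[OF assms] by (simp add: add_nonneg_pos)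
  ultimately have "ln (real K * T K + 1) \<le> ln (exp 1 * real K * x)"
    using x assms by (subst ln_le_cancel_iff) auto
  \<comment> \<open>The logarithm of \<open>exp 1 * K * ln K\<close> splits into exactly the three
    summands of \<open>T K\<close>.\<close>
  also have "\<dots> = T K" using x assms by (simp add: ln_mult T_def x_def)
  finally show ?thesis .
qed

subsection \<open>Truncated infima and harmonic means\<close>

text \<open>For \<open>c \<ge> 1\<close> the set is empty and the default 1 is used. For
  \<open>c = 0\<close> the infimum 0 is not attained, because 0 lies outside the open
  interval.\<close>

lemma inf_truncated_ray:
  fixes c :: real
  assumes "c \<ge> 0" and "S = {\<alpha>\<in>{0<..<1}. c \<le> \<alpha>}"
  shows "(if S = {} then 1 else Inf S) = min 1 c"
proof (cases "c \<ge> 1")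
  case True
  thus ?thesis using assms by auto
next
  case False
  show ?thesis
  proof (cases "c = 0")
    case True
    hence "S = {0<..<1}" using assms by auto
    thus ?thesis using True by simp
  next
    case c0: False
    hence "S = {c..<1}" using assms False by auto
    thus ?thesis using False by simp
  qed
qed

text \<open>With \<open>R\<close> the sum of the reciprocals and \<open>n\<close> the length, the
  sum is \<open>(\<alpha> * R - n) / t\<close> and the harmonic mean is \<open>n / R\<close>, so
  both sides say \<open>k * t + n \<le> \<alpha> * R\<close>.\<close>

lemma le_sum_list_iff_harmonic_mean:
  assumes "\<And>x. x \<in> set xs \<Longrightarrow> x > 0" and "xs \<noteq> []" and "t > 0"
  shows "k \<le> (\<Sum>x\<leftarrow>xs. (\<alpha> / x - 1) / t) \<longleftrightarrow>
     (k * t / real (length xs) + 1) * harmonic_mean xs \<le> \<alpha>"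
proof -
  define R where "R = (\<Sum>x\<leftarrow>xs. 1 / x)"
  have sum: "(\<Sum>x\<leftarrow>xs. (\<alpha> / x - 1) / t) = (\<alpha> * R - real (length xs)) / t"
    unfolding R_def by (induction xs) (auto simp: field_simps add_divide_distrib diff_divide_distrib)
  have R: "R > 0"
    using assms(2,1) unfolding R_def
    by (induction xs rule: list_nonempty_induct) (auto intro!: add_pos_pos)
  have "0 \<notin> set xs" using assms(1) by force
  hence hm: "harmonic_mean xs = real (length xs) / R"
    by (simp add: harmonic_mean_def R_def inverse_eq_divide)
  have eq: "(k * t / real (length xs) + 1) * harmonic_mean xs = (k * t + real (length xs)) / R"
    using assms(2) R by (simp add: hm divide_simps)
  show ?thesis using R assms(3) unfolding sum eq by (simp add: field_simps)
qed

text \<open>As \<open>f\<close> decreases along the sorted list, its positive values form an initial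
  segment, whose length is \<open>m\<close>.\<close>

lemma sorted_sum_positive_parts:
  fixes f :: "'a::linorder \<Rightarrow> real"
  assumes "sorted ys" and "\<And>x y. x \<in> set ys \<Longrightarrow> y \<in> set ys \<Longrightarrow> x \<le> y \<Longrightarrow> f y \<le> f x"
  shows "\<exists>m\<le>length ys. (\<Sum>y\<leftarrow>ys. max (f y) 0) = (\<Sum>y\<leftarrow>take m ys. f y)"
  using assms
proof (induction ys)
  case (Cons y ys)
  show ?case
  proof (cases "f y > 0")
    case True
    from Cons.IH Cons.prems obtain m
      where "m \<le> length ys" "(\<Sum>y\<leftarrow>ys. max (f y) 0) = (\<Sum>y\<leftarrow>take m ys. f y)" by auto
    thus ?thesis using True by (intro exI[of _ "Suc m"]) auto
  next
    case False
    have "max (f z) 0 = 0" if "z \<in> set (y # ys)" for z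
      using Cons.prems(1) Cons.prems(2)[of y z] that False by fastforce
    hence "(\<Sum>y\<leftarrow>y # ys. max (f y) 0) = 0"
      by (subst sum_list_nonneg_eq_0_iff) auto
    thus ?thesis by (intro exI[of _ 0]) simp
  qed
qed simp

text \<open>Each term is at most its positive part, and the omitted positive parts are nonnegative.
  Together with the equality above, the sum of positive parts over a sorted list is its largest
  prefix sum when \<open>f\<close> is decreasing.\<close>

lemma sum_list_take_le_sum_positive_parts:
  fixes f :: "'a \<Rightarrow> real"
  shows "(\<Sum>y\<leftarrow>take m ys. f y) \<le> (\<Sum>y\<leftarrow>ys. max (f y) 0)"
proof (induction ys arbitrary: m)
  case (Cons y ys)
  show ?case
  proof (cases m)
    case 0
    have "0 \<le> (\<Sum>y\<leftarrow>y # ys. max (f y) 0)" by (intro sum_list_nonneg) auto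
    thus ?thesis using 0 by simp
  next
    case (Suc n)
    show ?thesis using Cons.IH[of n] Suc by simp
  qed
qed simp

subsection \<open>Calibrator and maximal inequality\<close>

text \<open>Truncating at \<open>K\<close> makes the calibrator integrable without changing the events: an average
  of at most \<open>K\<close> nonnegative numbers is at least 1 as soon as one of them is \<open>K\<close>.\<close>

definition calib :: "nat \<Rightarrow> real \<Rightarrow> real \<Rightarrow> real" where
  "calib K \<alpha> p = (if p \<le> 0 then real K else min (real K) (max ((\<alpha> / p - 1) / T K) 0))"

lemma calib_bounds: "0 \<le> calib K \<alpha> p" "calib K \<alpha> p \<le> real K"
  by (auto simp: calib_def)

lemma borel_measurable_calib [measurable]: "calib K \<alpha> \<in> borel_measurable borel"
  unfolding calib_def by measurable

text \<open>This is the source of the monotonicity of \<open>F_EH\<close>.\<close>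

lemma calib_antimono:
  assumes "K \<ge> 2" and "\<alpha> > 0" and "p \<le> q"
  shows "calib K \<alpha> q \<le> calib K \<alpha> p"
proof (cases "p \<le> 0")
  case True
  thus ?thesis using calib_bounds[of K \<alpha> q] by (simp add: calib_def)
next
  case False
  have "(\<alpha> / q - 1) / T K \<le> (\<alpha> / p - 1) / T K"
    using False assms T_gt_1[OF assms(1)]
    by (intro divide_right_mono diff_right_mono divide_left_mono) auto
  thus ?thesis using False assms(3) unfolding calib_def by auto
qed

text \<open>The integrand is at most \<open>K\<close> on \<open>[0,a]\<close>, at most
  \<open>h\<close> on \<open>[a,\<alpha>]\<close> and zero above. The pieces add up to
  \<open>\<alpha> * ln (K * t + 1) / t\<close>, and \<open>ln_K_T_le_T\<close> finishes.\<close>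

lemma nn_integral_calib_le:
  assumes K: "K \<ge> 2" and \<alpha>: "0 < \<alpha>" "\<alpha> < 1"
  shows "(\<integral>\<^sup>+x. ennreal (calib K \<alpha> x) \<partial>uniform_measure lborel {0..1}) \<le> ennreal \<alpha>"
proof -
  define t where "t = T K"
  \<comment> \<open>This is the point at which \<open>(\<alpha> / x - 1) / t\<close> equals the
    truncation level \<open>K\<close>.\<close>
  define a where "a = \<alpha> / (real K * t + 1)"
  define h where "h = (\<lambda>x. (\<alpha> / x - 1) / t)"
  have t: "t > 1" using T_gt_1[OF K] by (simp add: t_def)
  have Kt: "real K * t + 1 > 1" using t K by simp
  have a: "a > 0" "a < \<alpha>" using \<alpha> Kt by (auto simp: a_def field_simps)
  have pt: "ennreal (calib K \<alpha> x) * indicator {0..1} x \<le>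
      ennreal (real K) * indicator {0..a} x + ennreal (h x) * indicator {a..\<alpha>} x" for x
  proof -
    consider "x < 0" | "0 \<le> x" "x \<le> a" | "a < x" "x \<le> \<alpha>" | "\<alpha> < x" by linarith
    thus ?thesis
    proof cases
      case 2
      have "ennreal (calib K \<alpha> x) \<le> ennreal (real K)"
        using calib_bounds by (intro ennreal_leI)
      also have "\<dots> \<le> ennreal (real K) + ennreal (h x) * indicator {a..\<alpha>} x" by simp
      finally show ?thesis using 2 a \<alpha> by simp
    next
      case 3
      hence "h x \<ge> 0" using a t by (simp add: h_def)
      hence "calib K \<alpha> x \<le> h x"
        using 3 a by (simp add: calib_def h_def t_def)
      thus ?thesis using 3 a \<alpha> by (simp add: ennreal_leI)
    next
      case 4
      hence "(\<alpha> / x - 1) / t \<le> 0" using \<alpha> t by (simp add: field_simps)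
      hence "calib K \<alpha> x = 0" using 4 \<alpha> by (simp add: calib_def t_def)
      thus ?thesis by simp
    qed simp
  qed
  define F where "F = (\<lambda>x. (\<alpha> * ln x - x) / t)"
  have h_meas [measurable]: "h \<in> borel_measurable borel" unfolding h_def by measurable
  have FTC: "(\<integral>\<^sup>+x. ennreal (h x) * indicator {a..\<alpha>} x \<partial>lborel) = ennreal (F \<alpha> - F a)"
  proof (rule nn_integral_FTC_Icc)
    show "h \<in> borel_measurable borel" by (fact h_meas)
    fix x assume x: "x \<in> {a..\<alpha>}"
    show "(F has_real_derivative h x) (at x)"
      unfolding F_def h_def
      using a x t by (auto intro!: derivative_eq_intros simp: field_simps)
    show "0 \<le> h x" using x a t by (simp add: h_def)
  qed (use a in auto)
  have "(\<integral>\<^sup>+x. ennreal (calib K \<alpha> x) \<partial>uniform_measure lborel {0..1}) =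
      (\<integral>\<^sup>+x. ennreal (calib K \<alpha> x) * indicator {0..1} x \<partial>lborel)"
    by (subst nn_integral_uniform_measure) (auto simp: divide_ennreal_def)
  also have "\<dots> \<le> (\<integral>\<^sup>+x. ennreal (real K) * indicator {0..a} x
      + ennreal (h x) * indicator {a..\<alpha>} x \<partial>lborel)"
    by (intro nn_integral_mono pt)
  also have "\<dots> = ennreal (real K) * ennreal a + ennreal (F \<alpha> - F a)"
    using a by (subst nn_integral_add) (simp_all add: FTC nn_integral_cmult_indicator h_meas)
  also have "\<dots> = ennreal (real K * a + (F \<alpha> - F a))"
  proof -
    \<comment> \<open>Nonnegativity of the difference allows the two \<open>ennreal\<close> summands
      to be merged into one real number.\<close>
    have "F a \<le> F \<alpha>"
    proof -
      have "ln (\<alpha> / a) \<ge> 1 - a / \<alpha>"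
        using ln_le_minus_one[of "a / \<alpha>"] a \<alpha> by (simp add: ln_div)
      hence "\<alpha> * (ln \<alpha> - ln a) \<ge> \<alpha> * (1 - a / \<alpha>)"
        using a \<alpha> by (intro mult_left_mono) (auto simp: ln_div)
      hence "\<alpha> * ln a - a \<le> \<alpha> * ln \<alpha> - \<alpha>" using \<alpha> by (simp add: algebra_simps)
      thus ?thesis using t by (simp add: F_def divide_right_mono)
    qed
    thus ?thesis using a by (simp add: ennreal_mult ennreal_plus)
  qed
  also have "real K * a + (F \<alpha> - F a) = \<alpha> * ln (real K * t + 1) / t"
  proof -
    have "ln a = ln \<alpha> - ln (real K * t + 1)" using \<alpha> Kt by (simp add: a_def ln_div)
    moreover have "(real K * t + 1) * a = \<alpha>" using Kt by (simp add: a_def)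
    \<comment> \<open>This cancels the linear part of \<open>F \<alpha> - F a\<close>, so only the
      logarithms remain.\<close>
    hence "real K * a = (\<alpha> - a) / t" using t by (simp add: field_simps)
    hence "real K * a + (F \<alpha> - F a) = \<alpha> * (ln \<alpha> - ln a) / t"
      by (simp add: F_def right_diff_distrib diff_divide_distrib)
    ultimately show ?thesis by simp
  qed
  also have "\<dots> \<le> \<alpha>"
    using ln_K_T_le_T[OF K] \<alpha> t by (simp add: t_def[symmetric] field_simps)
  finally show ?thesis by (simp add: ennreal_leI)
qed

text \<open>Split the event according to the last \<open>l\<close> whose partial sum is at least \<open>l\<close>. This index depends
  only on the partial sums from \<open>l\<close> on, so its event is invariant under exchanging 1 and \<open>i \<le> l\<close>.\<close>

lemma (in prob_space) exchangeable_maximal_inequality: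
  fixes P :: "'a \<Rightarrow> nat \<Rightarrow> real" and g :: "real \<Rightarrow> real"
  assumes P [measurable]: "P \<in> M \<rightarrow>\<^sub>M (\<Pi>\<^sub>M i\<in>{1..K}. borel)" and ex: "exchangeable M K P"
    and g [measurable]: "g \<in> borel_measurable borel" and g0: "\<And>x. 0 \<le> g x" and gB: "\<And>x. g x \<le> B"
    and K: "K \<ge> 1"
  shows "prob {\<omega>\<in>space M. \<exists>l\<in>{1..K}. real l \<le> (\<Sum>i=1..l. g (P \<omega> i))}
    \<le> expectation (\<lambda>\<omega>. g (P \<omega> 1))"
proof -
  let ?N = "\<Pi>\<^sub>M i\<in>{1..K}. (borel :: real measure)"
  define A where "A l x \<longleftrightarrow> real l \<le> (\<Sum>i=1..l. g (x i)) \<and>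
      (\<forall>k\<in>{l<..K}. (\<Sum>i=1..k. g (x i)) < real k)" for l x
  define E where "E l = {\<omega>\<in>space M. A l (P \<omega>)}" for l
  have comp: "(\<lambda>x. g (x i)) \<in> borel_measurable ?N" if "i \<in> {1..K}" for i
    using that by measurable
  have S: "(\<lambda>x. \<Sum>i=1..k. g (x i)) \<in> borel_measurable ?N" if "k \<le> K" for k
    using that by (intro borel_measurable_sum comp) auto
  have A_meas: "Measurable.pred ?N (A l)" if "l \<in> {1..K}" for l
    unfolding A_def
  proof (intro pred_intros_logic pred_intros_finite)
    show "Measurable.pred ?N (\<lambda>x. real l \<le> (\<Sum>i=1..l. g (x i)))"
      using S[of l] that by simp measurable
    show "Measurable.pred ?N (\<lambda>x. (\<Sum>i=1..k. g (x i)) < real k)" if "k \<in> {l<..K}" for k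
      using S[of k] that by simp measurable
  qed simp
  have E [measurable]: "E l \<in> sets M" if "l \<in> {1..K}" for l
    unfolding E_def using measurable_compose[OF P A_meas[OF that]] by measurable
  have gP [measurable]: "(\<lambda>\<omega>. g (P \<omega> i)) \<in> borel_measurable M" if "i \<in> {1..K}" for i
    using that by measurable
  have int: "integrable M (\<lambda>\<omega>. g (P \<omega> i) * indicator (E l) \<omega>)"
    if "i \<in> {1..K}" "l \<in> {1..K}" for i l
  proof (rule integrable_const_bound[of _ B])
    show "AE \<omega> in M. norm (g (P \<omega> i) * indicator (E l) \<omega>) \<le> B"
      using g0 gB order_trans[OF g0 gB] by (auto simp: indicator_def)
  qed (use that gP E in measurable)
  have swap: "expectation (\<lambda>\<omega>. g (P \<omega> i) * indicator (E l) \<omega>) =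
      expectation (\<lambda>\<omega>. g (P \<omega> 1) * indicator (E l) \<omega>)"
    if i: "i \<in> {1..l}" and l: "l \<in> {1..K}" for i l
  proof -
    \<comment> \<open>The integrand becomes a function of the whole vector, so that equality of laws
      applies. On \<open>E l\<close> its value is \<open>g (P \<omega> 1)\<close> at
      \<open>P \<omega>\<close> and \<open>g (P \<omega> i)\<close> at the swapped vector.\<close>
    define \<phi> where "\<phi> x = g (x 1) * indicator {x. A l x} x" for x :: "nat \<Rightarrow> real"
    define \<sigma> where "\<sigma> = Transposition.transpose 1 i"
    have \<sigma>: "\<sigma> permutes {1..k}" if "k \<ge> l" for k
      using i that by (auto simp: \<sigma>_def intro: permutes_swap_id)
    have \<phi>: "\<phi> \<in> borel_measurable ?N"
      unfolding \<phi>_def using A_meas[OF l] comp[of 1] K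
      by (intro borel_measurable_times borel_measurable_indicator') auto
    have Ps: "(\<lambda>\<omega>. \<lambda>j\<in>{1..K}. P \<omega> (\<sigma> j)) \<in> M \<rightarrow>\<^sub>M ?N"
      using permutes_in_image[OF \<sigma>[of K]] l by (intro measurable_restrict) (simp; measurable)
    define S where "S x k = (\<Sum>j=1..k. g (x j))" for x :: "nat \<Rightarrow> real" and k
    have S: "S (\<lambda>j\<in>{1..K}. P \<omega> (\<sigma> j)) k = S (P \<omega>) k" if "k \<in> {l..K}" for \<omega> k
    proof -
      have "S (\<lambda>j\<in>{1..K}. P \<omega> (\<sigma> j)) k = (\<Sum>j=1..k. g (P \<omega> (\<sigma> j)))"
        unfolding S_def using that by (intro sum.cong) auto
      also have "\<dots> = S (P \<omega>) k"
        using sum.permute[OF \<sigma>[of k], of "\<lambda>j. g (P \<omega> j)"] that by (simp add: o_def S_def)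
      finally show ?thesis .
    qed
    have "A l x \<longleftrightarrow> real l \<le> S x l \<and> (\<forall>k\<in>{l<..K}. S x k < real k)" for x
      by (simp add: A_def S_def)
    hence "A l (\<lambda>j\<in>{1..K}. P \<omega> (\<sigma> j)) \<longleftrightarrow> A l (P \<omega>)" for \<omega>
      using S l by auto
    moreover have "\<sigma> 1 = i" by (simp add: \<sigma>_def)
    ultimately have "expectation (\<lambda>\<omega>. g (P \<omega> i) * indicator (E l) \<omega>) =
        expectation (\<lambda>\<omega>. \<phi> (\<lambda>j\<in>{1..K}. P \<omega> (\<sigma> j)))"
      using K by (intro Bochner_Integration.integral_cong) (auto simp: \<phi>_def E_def indicator_def)
    also have "\<dots> = integral\<^sup>L (distr M ?N (\<lambda>\<omega>. \<lambda>j\<in>{1..K}. P \<omega> (\<sigma> j))) \<phi>"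
      using Ps \<phi> by (simp add: integral_distr)
    also have "\<dots> = integral\<^sup>L (distr M ?N P) \<phi>"
      using ex \<sigma>[of K] l by (simp add: exchangeable_def)
    also have "\<dots> = expectation (\<lambda>\<omega>. \<phi> (P \<omega>))"
      using P \<phi> by (simp add: integral_distr)
    also have "\<dots> = expectation (\<lambda>\<omega>. g (P \<omega> 1) * indicator (E l) \<omega>)"
      by (intro Bochner_Integration.integral_cong) (auto simp: \<phi>_def E_def indicator_def)
    finally show ?thesis .
  qed
  have bound: "prob (E l) \<le> expectation (\<lambda>\<omega>. g (P \<omega> 1) * indicator (E l) \<omega>)"
    if l: "l \<in> {1..K}" for l
  proof -
    \<comment> \<open>On \<open>E l\<close> the first \<open>l\<close> values sum to at least
      \<open>l\<close>, and by \<open>swap\<close> each of them has the same expectation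
      there.\<close>
    have "real l * prob (E l) = expectation (\<lambda>\<omega>. real l * indicator (E l) \<omega>)"
      using E[OF l] by simp
    also have "\<dots> \<le> expectation (\<lambda>\<omega>. \<Sum>i=1..l. g (P \<omega> i) * indicator (E l) \<omega>)"
    proof (rule integral_mono)
      show "integrable M (\<lambda>\<omega>. real l * indicator (E l) \<omega> :: real)"
        using E[OF l] by (intro integrable_mult_right integrable_real_indicator) (simp_all add: emeasure_eq_measure)
      show "integrable M (\<lambda>\<omega>. \<Sum>i=1..l. g (P \<omega> i) * indicator (E l) \<omega>)"
        using l by (intro Bochner_Integration.integrable_sum int) auto
      show "real l * indicator (E l) \<omega> \<le> (\<Sum>i=1..l. g (P \<omega> i) * indicator (E l) \<omega>)" for \<omega>
        by (auto simp: indicator_def E_def A_def)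
    qed
    also have "\<dots> = (\<Sum>i=1..l. expectation (\<lambda>\<omega>. g (P \<omega> i) * indicator (E l) \<omega>))"
      using l by (intro Bochner_Integration.integral_sum int) auto
    also have "\<dots> = (\<Sum>i=1..l. expectation (\<lambda>\<omega>. g (P \<omega> 1) * indicator (E l) \<omega>))"
      by (intro sum.cong refl swap l)
    also have "\<dots> = real l * expectation (\<lambda>\<omega>. g (P \<omega> 1) * indicator (E l) \<omega>)" by simp
    finally show ?thesis using l by simp
  qed
  have disj: "disjoint_family_on E {1..K}"
    unfolding disjoint_family_on_def
  proof (intro ballI impI)
    fix l k assume "l \<in> {1..K}" "k \<in> {1..K}" "l \<noteq> k"
    thus "E l \<inter> E k = {}"
      by (cases l k rule: linorder_cases) (force simp: E_def A_def)+
  qed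
  have "{\<omega>\<in>space M. \<exists>l\<in>{1..K}. real l \<le> (\<Sum>i=1..l. g (P \<omega> i))} = (\<Union>l\<in>{1..K}. E l)"
  proof (intro equalityI subsetI)
    fix \<omega> assume \<omega>: "\<omega> \<in> {\<omega>\<in>space M. \<exists>l\<in>{1..K}. real l \<le> (\<Sum>i=1..l. g (P \<omega> i))}"
    define L where "L = {l\<in>{1..K}. real l \<le> (\<Sum>i=1..l. g (P \<omega> i))}"
    have L: "finite L" "L \<noteq> {}" using \<omega> by (auto simp: L_def)
    have "A (Max L) (P \<omega>)"
      unfolding A_def
    proof (intro conjI ballI)
      show "real (Max L) \<le> (\<Sum>i=1..Max L. g (P \<omega> i))"
        using Max_in[OF L] by (simp add: L_def)
      fix k assume "k \<in> {Max L<..K}"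
      hence "k \<notin> L" "k \<in> {1..K}" using Max_ge[OF L(1), of k] by auto
      thus "(\<Sum>i=1..k. g (P \<omega> i)) < real k" by (auto simp: L_def)
    qed
    thus "\<omega> \<in> (\<Union>l\<in>{1..K}. E l)" using Max_in[OF L] \<omega> by (auto simp: E_def L_def)
  qed (auto simp: E_def A_def)
  hence "prob {\<omega>\<in>space M. \<exists>l\<in>{1..K}. real l \<le> (\<Sum>i=1..l. g (P \<omega> i))} = (\<Sum>l=1..K. prob (E l))"
    using disj E by (simp add: finite_measure_finite_Union image_subset_iff)
  also have "\<dots> \<le> (\<Sum>l=1..K. expectation (\<lambda>\<omega>. g (P \<omega> 1) * indicator (E l) \<omega>))"
    by (intro sum_mono bound)
  also have "\<dots> = expectation (\<lambda>\<omega>. \<Sum>l=1..K. g (P \<omega> 1) * indicator (E l) \<omega>)"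
    using K by (intro Bochner_Integration.integral_sum[symmetric] int) auto
  also have "\<dots> \<le> expectation (\<lambda>\<omega>. g (P \<omega> 1))"
  proof (rule integral_mono)
    show "integrable M (\<lambda>\<omega>. \<Sum>l=1..K. g (P \<omega> 1) * indicator (E l) \<omega>)"
      using K by (intro Bochner_Integration.integrable_sum int) auto
    show "integrable M (\<lambda>\<omega>. g (P \<omega> 1))"
      using g0 gB gP K by (intro integrable_const_bound[of _ B]) auto
    fix \<omega>
    \<comment> \<open>By disjointness the indicators sum to at most 1, so the pieces together cost
      no more than a single expectation.\<close>
    have "(\<Sum>l=1..K. indicator (E l) \<omega>) = (indicator (\<Union>l\<in>{1..K}. E l) \<omega> :: real)"
      using disj by (simp add: indicator_UN_disjoint)
    hence "(\<Sum>l=1..K. g (P \<omega> 1) * indicator (E l) \<omega>) = g (P \<omega> 1) * indicator (\<Union>l\<in>{1..K}. E l) \<omega>"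
      by (simp add: sum_distrib_left[symmetric])
    also have "\<dots> \<le> g (P \<omega> 1)" using g0[of "P \<omega> 1"] by (simp add: indicator_def)
    finally show "(\<Sum>l=1..K. g (P \<omega> 1) * indicator (E l) \<omega>) \<le> g (P \<omega> 1)" .
  qed
  finally show ?thesis .
qed

text \<open>The maximal inequality with \<open>g = calib K \<alpha>\<close> and bound
  \<open>K\<close> leaves the expectation at the first component, which is an integral against the
  uniform law.\<close>

lemma (in prob_space) prob_calib_average_ge_1_le:
  assumes K: "K \<ge> 2" and \<alpha>: "0 < \<alpha>" "\<alpha> < 1"
    and P: "P \<in> uniform_vectors M K" and ex: "exchangeable M K P"
  shows "prob {\<omega>\<in>space M. \<exists>l\<in>{1..K}. real l \<le> (\<Sum>i=1..l. calib K \<alpha> (P \<omega> i))} \<le> \<alpha>"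
proof -
  have Pm [measurable]: "P \<in> M \<rightarrow>\<^sub>M (\<Pi>\<^sub>M i\<in>{1..K}. borel)"
    and unif: "distr M borel (\<lambda>\<omega>. P \<omega> 1) = uniform_measure lborel {0..1}"
    using P K by (auto simp: uniform_vectors_def)
  have P1 [measurable]: "(\<lambda>\<omega>. P \<omega> 1) \<in> borel_measurable M"
    using measurable_compose[OF Pm measurable_component_singleton[of 1 "{1..K}"]] K by simp
  have "prob {\<omega>\<in>space M. \<exists>l\<in>{1..K}. real l \<le> (\<Sum>i=1..l. calib K \<alpha> (P \<omega> i))}
      \<le> expectation (\<lambda>\<omega>. calib K \<alpha> (P \<omega> 1))"
    using K by (intro exchangeable_maximal_inequality[OF Pm ex, of _ "real K"])
      (auto simp: calib_bounds)
  also have "\<dots> = enn2real (\<integral>\<^sup>+\<omega>. ennreal (calib K \<alpha> (P \<omega> 1)) \<partial>M)"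
    using measurable_compose[OF P1 borel_measurable_calib]
    by (intro integral_eq_nn_integral) (simp_all add: calib_bounds)
  also have "(\<integral>\<^sup>+\<omega>. ennreal (calib K \<alpha> (P \<omega> 1)) \<partial>M) =
      (\<integral>\<^sup>+x. ennreal (calib K \<alpha> x) \<partial>uniform_measure lborel {0..1})"
    unfolding unif[symmetric] using P1 by (subst nn_integral_distr) simp_all
  also have "enn2real \<dots> \<le> \<alpha>"
    using nn_integral_calib_le[OF K \<alpha>] \<alpha> by (intro enn2real_leI) auto
  finally show ?thesis .
qed

subsection \<open>Closed forms and comparison\<close>

lemma set_initial_vec: "set (initial_vec p l) = p ` {1..l}"
  by (auto simp: initial_vec_def)

lemma length_initial_vec: "length (initial_vec p l) = l"
  by (simp add: initial_vec_def)

lemma set_smallest_vec: "set (smallest_vec p l m) \<subseteq> p ` {1..l}"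
  unfolding smallest_vec_def using set_take_subset[of m "sort (initial_vec p l)"]
  by (simp add: set_initial_vec)

lemma sum_list_initial_vec: "(\<Sum>x\<leftarrow>initial_vec p l. f x) = (\<Sum>i=1..l. f (p i))"
  by (simp add: initial_vec_def interv_sum_list_conv_sum_set_nat o_def
      atLeastLessThanSuc_atLeastAtMost del: upt_Suc)

lemma harmonic_mean_initial_vec:
  "harmonic_mean (initial_vec p m) =
     (if \<exists>i\<in>{1..m}. p i = 0 then 0 else real m * inverse (\<Sum>i=1..m. 1 / p i))"
  unfolding harmonic_mean_def sum_list_initial_vec
  by (auto simp: set_initial_vec length_initial_vec image_iff)

lemma harmonic_mean_sort: "harmonic_mean (sort xs) = harmonic_mean xs"
  using sum_mset_sum_list[of "map (\<lambda>x. 1 / x) (sort xs)"] sum_mset_sum_list[of "map (\<lambda>x. 1 / x) xs"]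
  by (simp add: harmonic_mean_def)

text \<open>This identifies the diagonal terms \<open>m = l\<close> of the double minimum with the
  terms of the closed form of \<open>F'_EH\<close>.\<close>

lemma harmonic_mean_smallest_vec_full:
  "harmonic_mean (smallest_vec p l l) = harmonic_mean (initial_vec p l)"
  by (simp add: smallest_vec_def length_initial_vec harmonic_mean_sort)

lemma harmonic_mean_nonneg: "(\<And>x. x \<in> set xs \<Longrightarrow> 0 \<le> x) \<Longrightarrow> 0 \<le> harmonic_mean xs"
  by (auto simp: harmonic_mean_def intro!: mult_nonneg_nonneg sum_list_nonneg)

lemma cube_bounds: "p \<in> cube K \<Longrightarrow> i \<in> {1..K} \<Longrightarrow> 0 \<le> p i \<and> p i \<le> 1"
  by (auto simp: cube_def)

text \<open>All entries are nonnegative, so a zero entry puts 0 at the head of the sorted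
  list.\<close>

lemma zero_in_smallest_vec:
  assumes p: "p \<in> cube K" and l: "l \<le> K" and i: "i \<in> {1..l}" "p i = 0" and m: "m \<ge> 1"
  shows "0 \<in> set (smallest_vec p l m)"
proof -
  let ?ys = "sort (initial_vec p l)"
  have z: "0 \<in> set ?ys" using i by (force simp: set_initial_vec)
  then obtain y ys where ys: "?ys = y # ys" by (cases ?ys) auto
  have "y \<in> p ` {1..l}" using ys set_initial_vec[of p l]
    by (metis list.set_intros(1) set_sort)
  hence "y \<ge> 0" using cube_bounds[OF p] l by auto
  moreover have "y \<le> 0" using z sorted_sort[of "initial_vec p l"] unfolding ys by auto
  ultimately show ?thesis using m ys by (cases m) (auto simp: smallest_vec_def)
qed

section \<open>From extended-real averages to harmonic means\<close>

lemma one_le_ereal_average_iff: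
  "l > 0 \<Longrightarrow> 1 \<le> ereal (1 / real l) * ereal x \<longleftrightarrow> real l \<le> x"
  by (simp add: field_simps one_ereal_def)

text \<open>A zero component makes the average infinite; otherwise all terms are finite. The zero
  case is a separate disjunct because real division by 0 yields 0 instead of infinity.\<close>

lemma EH_average_ge_1_iff:
  assumes t: "t > 0" and \<alpha>: "\<alpha> > 0" and l: "l \<in> {1..K}"
  shows "ereal (1 / real l) * (\<Sum>i=1..l. max (ereal \<alpha> / ereal (t * p i) - ereal (1 / t)) 0) \<ge> 1
    \<longleftrightarrow> (\<exists>i\<in>{1..l}. p i = 0) \<or> real l \<le> (\<Sum>i=1..l. max ((\<alpha> / p i - 1) / t) 0)"
proof (cases "\<exists>i\<in>{1..l}. p i = 0")
  case True
  then obtain i where i: "i \<in> {1..l}" "p i = 0" by blast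
  hence "max (ereal \<alpha> / ereal (t * p i) - ereal (1 / t)) 0 = \<infinity>"
    using \<alpha> by (simp add: divide_ereal_def)
  hence "(\<Sum>i=1..l. max (ereal \<alpha> / ereal (t * p i) - ereal (1 / t)) 0) = \<infinity>"
    using i by (subst sum_Pinfty) blast
  thus ?thesis using i l by auto
next
  case False
  have "max (ereal \<alpha> / ereal (t * p i) - ereal (1 / t)) 0 = ereal (max ((\<alpha> / p i - 1) / t) 0)"
    if "i \<in> {1..l}" for i
    using False that t by (auto simp: max_def field_simps zero_ereal_def)
  hence "(\<Sum>i=1..l. max (ereal \<alpha> / ereal (t * p i) - ereal (1 / t)) 0) =
      (\<Sum>i=1..l. ereal (max ((\<alpha> / p i - 1) / t) 0))"
    by (intro sum.cong refl)
  hence "(\<Sum>i=1..l. max (ereal \<alpha> / ereal (t * p i) - ereal (1 / t)) 0) =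
      ereal (\<Sum>i=1..l. max ((\<alpha> / p i - 1) / t) 0)"
    by (simp only: sum_ereal)
  moreover have "l > 0" using l by simp
  ultimately show ?thesis using False by (simp only: one_le_ereal_average_iff simp_thms)
qed

text \<open>Summands may now be negative, but none is minus infinity, so a zero component still
  forces an infinite sum.\<close>

lemma EH'_average_ge_1_iff:
  assumes t: "t > 0" and \<alpha>: "\<alpha> > 0" and l: "l \<in> {1..K}"
  shows "ereal (1 / real l) * (\<Sum>i=1..l. ereal \<alpha> / ereal (t * p i) - ereal (1 / t)) \<ge> 1
    \<longleftrightarrow> (\<exists>i\<in>{1..l}. p i = 0) \<or> real l \<le> (\<Sum>i=1..l. (\<alpha> / p i - 1) / t)"
proof (cases "\<exists>i\<in>{1..l}. p i = 0")
  case True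
  then obtain i where i: "i \<in> {1..l}" "p i = 0" by blast
  hence "ereal \<alpha> / ereal (t * p i) - ereal (1 / t) = \<infinity>"
    using \<alpha> by (simp add: divide_ereal_def)
  hence "(\<Sum>i=1..l. ereal \<alpha> / ereal (t * p i) - ereal (1 / t)) = \<infinity>"
    using i by (subst sum_Pinfty) blast
  thus ?thesis using i l by auto
next
  case False
  have "ereal \<alpha> / ereal (t * p i) - ereal (1 / t) = ereal ((\<alpha> / p i - 1) / t)"
    if "i \<in> {1..l}" for i
    using False that t by (auto simp: field_simps)
  hence "(\<Sum>i=1..l. ereal \<alpha> / ereal (t * p i) - ereal (1 / t)) =
      ereal (\<Sum>i=1..l. (\<alpha> / p i - 1) / t)"
    by simp
  thus ?thesis using False l by (simp add: field_simps one_ereal_def)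
qed

text \<open>Sorting preserves the sum of positive parts, which is then the largest prefix sum, and a
  prefix sum of at least \<open>l\<close> is a harmonic mean bound. If a component is zero,
  \<open>m = 1\<close> is a witness with harmonic mean 0.\<close>

lemma EH_average_iff_harmonic_mean:
  assumes t: "t > 0" and p: "p \<in> cube K" and \<alpha>: "\<alpha> > 0" and l: "l \<in> {1..K}"
  shows "(\<exists>i\<in>{1..l}. p i = 0) \<or> real l \<le> (\<Sum>i=1..l. max ((\<alpha> / p i - 1) / t) 0)
    \<longleftrightarrow> (\<exists>m\<in>{1..l}. (real l * t / real m + 1) * harmonic_mean (smallest_vec p l m) \<le> \<alpha>)"
proof (cases "\<exists>i\<in>{1..l}. p i = 0")
  case True
  then obtain i where "i \<in> {1..l}" "p i = 0" by blast
  hence "0 \<in> set (smallest_vec p l 1)"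
    using zero_in_smallest_vec[OF p, of l i 1] l by auto
  hence "harmonic_mean (smallest_vec p l 1) = 0" by (simp add: harmonic_mean_def)
  hence "(real l * t / real 1 + 1) * harmonic_mean (smallest_vec p l 1) \<le> \<alpha>" using \<alpha> by simp
  moreover have "1 \<in> {1..l}" using l by simp
  ultimately show ?thesis using True by blast
next
  case False
  have pos: "x > 0" if "x \<in> p ` {1..l}" for x
    using that False cube_bounds[OF p] l by (fastforce simp: less_le)
  let ?f = "\<lambda>x. (\<alpha> / x - 1) / t"
  let ?ys = "sort (initial_vec p l)"
  have len: "length ?ys = l" by (simp add: length_initial_vec)
  have mset: "(\<Sum>i=1..l. max (?f (p i)) 0) = (\<Sum>y\<leftarrow>?ys. max (?f y) 0)"
    unfolding sum_list_initial_vec[of "\<lambda>x. max (?f x) 0" p l, symmetric]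
    by (simp flip: sum_mset_sum_list)
  have core: "real l \<le> (\<Sum>y\<leftarrow>take m ?ys. ?f y) \<longleftrightarrow>
      (real l * t / real m + 1) * harmonic_mean (smallest_vec p l m) \<le> \<alpha>"
    if m: "m \<in> {1..l}" for m
  proof -
    have ln: "length (take m ?ys) = m" using m len by simp
    have "take m ?ys \<noteq> []" using m ln by (metis atLeastAtMost_iff list.size(3) not_one_le_zero)
    moreover have "x > 0" if "x \<in> set (take m ?ys)" for x
      using pos that set_smallest_vec[of p l m] by (auto simp: smallest_vec_def)
    ultimately show ?thesis
      using le_sum_list_iff_harmonic_mean[of "take m ?ys" t "real l" \<alpha>] t
      unfolding smallest_vec_def ln by blast
  qed
  have "real l \<le> (\<Sum>y\<leftarrow>?ys. max (?f y) 0) \<longleftrightarrow> (\<exists>m\<in>{1..l}. real l \<le> (\<Sum>y\<leftarrow>take m ?ys. ?f y))"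
  proof
    assume le: "real l \<le> (\<Sum>y\<leftarrow>?ys. max (?f y) 0)"
    have "?f y \<le> ?f x" if "x \<in> set ?ys" "y \<in> set ?ys" "x \<le> y" for x y
      using that pos[of x] pos[of y] \<alpha> t
      by (intro divide_right_mono diff_right_mono divide_left_mono) (auto simp: set_initial_vec)
    then obtain m where m: "m \<le> l" "(\<Sum>y\<leftarrow>?ys. max (?f y) 0) = (\<Sum>y\<leftarrow>take m ?ys. ?f y)"
      using sorted_sum_positive_parts[of ?ys ?f] len by auto
    \<comment> \<open>The empty prefix has sum 0, which is below \<open>l\<close>.\<close>
    have "m \<noteq> 0" using m le l by (intro notI) auto
    thus "\<exists>m\<in>{1..l}. real l \<le> (\<Sum>y\<leftarrow>take m ?ys. ?f y)" using m le by (intro bexI[of _ m]) auto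
  next
    assume "\<exists>m\<in>{1..l}. real l \<le> (\<Sum>y\<leftarrow>take m ?ys. ?f y)"
    thus "real l \<le> (\<Sum>y\<leftarrow>?ys. max (?f y) 0)"
      using sum_list_take_le_sum_positive_parts order_trans by blast
  qed
  thus ?thesis using False core mset by auto
qed

text \<open>If some value of \<open>calib\<close> equals \<open>K\<close>, both sides hold because
  that component alone suffices; otherwise the truncation is inactive and the sums agree term by
  term.\<close>

lemma EH_average_iff_calib:
  assumes K: "K \<ge> 2" and p: "p \<in> cube K" and l: "l \<in> {1..K}"
  shows "(\<exists>i\<in>{1..l}. p i = 0) \<or> real l \<le> (\<Sum>i=1..l. max ((\<alpha> / p i - 1) / T K) 0)
    \<longleftrightarrow> real l \<le> (\<Sum>i=1..l. calib K \<alpha> (p i))"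
proof (cases "\<exists>i\<in>{1..l}. calib K \<alpha> (p i) = real K")
  case True
  then obtain i where i: "i \<in> {1..l}" "calib K \<alpha> (p i) = real K" by blast
  have "real K \<le> (\<Sum>i=1..l. calib K \<alpha> (p i))"
    using member_le_sum[of i "{1..l}" "\<lambda>i. calib K \<alpha> (p i)"] i by (auto simp: calib_bounds)
  moreover have "real l \<le> (\<Sum>i=1..l. max ((\<alpha> / p i - 1) / T K) 0)" if "p i \<noteq> 0"
  proof -
    have "p i > 0" using that cube_bounds[OF p, of i] i l by auto
    hence "real K \<le> max ((\<alpha> / p i - 1) / T K) 0"
      using i by (auto simp: calib_def min_def split: if_splits)
    also have "\<dots> \<le> (\<Sum>i=1..l. max ((\<alpha> / p i - 1) / T K) 0)"
      using member_le_sum[of i "{1..l}" "\<lambda>i. max ((\<alpha> / p i - 1) / T K) 0"] i by auto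
    finally show ?thesis using l by simp
  qed
  moreover have "real l \<le> real K" using l by simp
  ultimately show ?thesis using i(1) order_trans by blast
next
  case False
  hence "\<not> (\<exists>i\<in>{1..l}. p i = 0)" by (auto simp: calib_def)
  moreover have "(\<Sum>i=1..l. max ((\<alpha> / p i - 1) / T K) 0) = (\<Sum>i=1..l. calib K \<alpha> (p i))"
    using False by (intro sum.cong) (auto simp: calib_def min_def split: if_splits)
  ultimately show ?thesis by simp
qed

text \<open>All \<open>l\<close> entries are used, so the factor \<open>k * t / length + 1\<close>
  with \<open>k = l\<close> becomes \<open>t + 1\<close>.\<close>

lemma EH'_average_iff_harmonic_mean:
  assumes t: "t > 0" and p: "p \<in> cube K" and \<alpha>: "\<alpha> > 0" and l: "l \<in> {1..K}"
  shows "(\<exists>i\<in>{1..l}. p i = 0) \<or> real l \<le> (\<Sum>i=1..l. (\<alpha> / p i - 1) / t)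
    \<longleftrightarrow> (t + 1) * harmonic_mean (initial_vec p l) \<le> \<alpha>"
proof (cases "\<exists>i\<in>{1..l}. p i = 0")
  case True
  thus ?thesis using \<alpha> by (auto simp: harmonic_mean_initial_vec)
next
  case False
  have "x > 0" if "x \<in> set (initial_vec p l)" for x
    using that False cube_bounds[OF p] l by (fastforce simp: less_le set_initial_vec)
  moreover have "initial_vec p l \<noteq> []" using l by (auto simp: initial_vec_def)
  ultimately show ?thesis
    using le_sum_list_iff_harmonic_mean[of "initial_vec p l" t "real l" \<alpha>] t l False
    by (simp add: length_initial_vec sum_list_initial_vec)
qed

lemma le_MAX_iff:
  fixes h :: "'i \<Rightarrow> 'b::linorder"
  shows "finite A \<Longrightarrow> A \<noteq> {} \<Longrightarrow> a \<le> (MAX x\<in>A. h x) \<longleftrightarrow> (\<exists>x\<in>A. a \<le> h x)"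
  by (subst Max_ge_iff) auto

lemma MIN_le_iff:
  fixes h :: "'i \<Rightarrow> 'b::linorder"
  shows "finite A \<Longrightarrow> A \<noteq> {} \<Longrightarrow> (MIN x\<in>A. h x) \<le> a \<longleftrightarrow> (\<exists>x\<in>A. h x \<le> a)"
  by (subst Min_le_iff) auto

lemma le_MIN_iff:
  fixes h :: "'i \<Rightarrow> 'b::linorder"
  shows "finite A \<Longrightarrow> A \<noteq> {} \<Longrightarrow> a \<le> (MIN x\<in>A. h x) \<longleftrightarrow> (\<forall>x\<in>A. a \<le> h x)"
  by (subst Min_ge_iff) auto

lemma MIN_MIN_le_iff:
  fixes h :: "nat \<Rightarrow> nat \<Rightarrow> 'b::linorder"
  assumes "K \<ge> 2"
  shows "(MIN l\<in>{1..K}. MIN m\<in>{1..l}. h l m) \<le> a \<longleftrightarrow> (\<exists>l\<in>{1..K}. \<exists>m\<in>{1..l}. h l m \<le> a)"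
  using assms by (simp add: MIN_le_iff)

section \<open>Closed forms\<close>

text \<open>For positive \<open>\<alpha>\<close> the defining condition says that
  \<open>\<alpha>\<close> is at least the double minimum, so the infimum is taken over a ray
  truncated to the open unit interval.\<close>

lemma F_EH_eq_Min:
  assumes K: "K \<ge> 2" and p: "p \<in> cube K"
  shows "F_EH K p = min 1 (MIN l\<in>{1..K}. MIN m\<in>{1..l}.
           (real l * T K / real m + 1) * harmonic_mean (smallest_vec p l m))"
    (is "_ = min 1 ?c")
proof -
  have t: "T K > 0" using T_gt_1[OF K] by simp
  have "(MAX l\<in>{1..K}. ereal (1 / real l) *
          (\<Sum>i=1..l. max (ereal \<alpha> / ereal (T K * p i) - ereal (1 / T K)) 0)) \<ge> 1 \<longleftrightarrow> ?c \<le> \<alpha>"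
    if "\<alpha> > 0" for \<alpha>
  proof -
    let ?g = "\<lambda>l. ereal (1 / real l) *
          (\<Sum>i=1..l. max (ereal \<alpha> / ereal (T K * p i) - ereal (1 / T K)) 0)"
    let ?h = "\<lambda>l m. (real l * T K / real m + 1) * harmonic_mean (smallest_vec p l m)"
    have "1 \<le> (MAX l\<in>{1..K}. ?g l) \<longleftrightarrow> (\<exists>l\<in>{1..K}. 1 \<le> ?g l)"
      using K by (intro le_MAX_iff) auto
    also have "\<dots> \<longleftrightarrow> (\<exists>l\<in>{1..K}. \<exists>m\<in>{1..l}. ?h l m \<le> \<alpha>)"
      by (intro bex_cong refl)
        (simp only: EH_average_ge_1_iff[OF t that] EH_average_iff_harmonic_mean[OF t p that])
    also have "\<dots> \<longleftrightarrow> ?c \<le> \<alpha>" using K by (rule MIN_MIN_le_iff[symmetric])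
    finally show ?thesis .
  qed
  hence "{\<alpha>\<in>{0<..<1}. (MAX l\<in>{1..K}. ereal (1 / real l) *
          (\<Sum>i=1..l. max (ereal \<alpha> / ereal (T K * p i) - ereal (1 / T K)) 0)) \<ge> 1} =
      {\<alpha>\<in>{0<..<1}. ?c \<le> \<alpha>}"
    by auto
  moreover have "?c \<ge> 0"
  proof -
    have "harmonic_mean (smallest_vec p l m) \<ge> 0" if "l \<in> {1..K}" for l m
      using set_smallest_vec[of p l m] cube_bounds[OF p] that
      by (intro harmonic_mean_nonneg) fastforce
    thus ?thesis using K t by (simp add: le_MIN_iff)
  qed
  ultimately show ?thesis using inf_truncated_ray[of ?c] by (simp add: F_EH_def Let_def)
qed

lemma F'_EH_eq_Min:
  assumes K: "K \<ge> 2" and p: "p \<in> cube K"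
  shows "F'_EH K p = min 1 (MIN m\<in>{1..K}. (T K + 1) * harmonic_mean (initial_vec p m))"
    (is "_ = min 1 ?c")
proof -
  have t: "T K > 0" using T_gt_1[OF K] by simp
  have "(MAX l\<in>{1..K}. ereal (1 / real l) *
          (\<Sum>i=1..l. ereal \<alpha> / ereal (T K * p i) - ereal (1 / T K))) \<ge> 1 \<longleftrightarrow> ?c \<le> \<alpha>"
    if "\<alpha> > 0" for \<alpha>
  proof -
    let ?g = "\<lambda>l. ereal (1 / real l) *
          (\<Sum>i=1..l. ereal \<alpha> / ereal (T K * p i) - ereal (1 / T K))"
    have "1 \<le> (MAX l\<in>{1..K}. ?g l) \<longleftrightarrow> (\<exists>l\<in>{1..K}. 1 \<le> ?g l)"
      using K by (intro le_MAX_iff) auto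
    also have "\<dots> \<longleftrightarrow> (\<exists>l\<in>{1..K}. (T K + 1) * harmonic_mean (initial_vec p l) \<le> \<alpha>)"
      by (intro bex_cong refl)
        (simp only: EH'_average_ge_1_iff[OF t that] EH'_average_iff_harmonic_mean[OF t p that])
    also have "\<dots> \<longleftrightarrow> ?c \<le> \<alpha>" using K by (intro MIN_le_iff[symmetric]) auto
    finally show ?thesis .
  qed
  hence "{\<alpha>\<in>{0<..<1}. (MAX l\<in>{1..K}. ereal (1 / real l) *
          (\<Sum>i=1..l. ereal \<alpha> / ereal (T K * p i) - ereal (1 / T K))) \<ge> 1} =
      {\<alpha>\<in>{0<..<1}. ?c \<le> \<alpha>}"
    by auto
  moreover have "?c \<ge> 0"
  proof -
    have "harmonic_mean (initial_vec p m) \<ge> 0" if "m \<in> {1..K}" for m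
      using cube_bounds[OF p] that by (intro harmonic_mean_nonneg) (auto simp: set_initial_vec)
    thus ?thesis using K t by (simp add: le_MIN_iff)
  qed
  ultimately show ?thesis using inf_truncated_ray[of ?c] by (simp add: F'_EH_def Let_def)
qed

section \<open>Sublevel sets, monotonicity and domination\<close>

text \<open>As \<open>\<alpha> < 1\<close>, the cap at 1 drops out of the closed form. The right
  side is the event of the maximal inequality and also serves for monotonicity and
  measurability.\<close>

lemma F_EH_le_iff:
  assumes K: "K \<ge> 2" and p: "p \<in> cube K" and \<alpha>: "0 < \<alpha>" "\<alpha> < 1"
  shows "F_EH K p \<le> \<alpha> \<longleftrightarrow> (\<exists>l\<in>{1..K}. real l \<le> (\<Sum>i=1..l. calib K \<alpha> (p i)))"
proof -
  have t: "T K > 0" using T_gt_1[OF K] by simp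
  have "F_EH K p \<le> \<alpha> \<longleftrightarrow> (\<exists>l\<in>{1..K}. \<exists>m\<in>{1..l}.
      (real l * T K / real m + 1) * harmonic_mean (smallest_vec p l m) \<le> \<alpha>)"
    using \<alpha> unfolding F_EH_eq_Min[OF K p] min_le_iff_disj MIN_MIN_le_iff[OF K] by simp
  thus ?thesis
    using EH_average_iff_harmonic_mean[OF t p \<alpha>(1)] EH_average_iff_calib[OF K p] by simp
qed

lemma F_EH_bounds:
  assumes "K \<ge> 2" and "p \<in> cube K"
  shows "0 \<le> F_EH K p" and "F_EH K p \<le> 1"
proof -
  show "F_EH K p \<le> 1" by (simp add: F_EH_eq_Min[OF assms])
  show "0 \<le> F_EH K p"
    unfolding F_EH_def Let_def by (auto intro!: cInf_greatest)
qed

text \<open>A level strictly between two wrongly ordered values lies in the open unit interval,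
  where the condition on the sums of \<open>calib\<close> passes from \<open>q\<close> to the
  smaller \<open>p\<close>.\<close>

lemma F_EH_mono:
  assumes K: "K \<ge> 2" and p: "p \<in> cube K" and q: "q \<in> cube K" and le: "\<forall>i\<in>{1..K}. p i \<le> q i"
  shows "F_EH K p \<le> F_EH K q"
proof (rule ccontr)
  assume "\<not> F_EH K p \<le> F_EH K q"
  hence "F_EH K q < F_EH K p" by simp
  then obtain \<alpha> where \<alpha>: "F_EH K q < \<alpha>" "\<alpha> < F_EH K p" using dense by blast
  have \<alpha>': "0 < \<alpha>" "\<alpha> < 1" using \<alpha> F_EH_bounds[OF K p] F_EH_bounds[OF K q] by auto
  then obtain l where l: "l \<in> {1..K}" "real l \<le> (\<Sum>i=1..l. calib K \<alpha> (q i))"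
    using F_EH_le_iff[OF K q \<alpha>'] \<alpha>(1) less_imp_le by blast
  note l(2)
  also have "(\<Sum>i=1..l. calib K \<alpha> (q i)) \<le> (\<Sum>i=1..l. calib K \<alpha> (p i))"
    using le l \<alpha>' K by (intro sum_mono calib_antimono) auto
  finally have "F_EH K p \<le> \<alpha>" using F_EH_le_iff[OF K p \<alpha>'] l by blast
  thus False using \<alpha> by simp
qed

text \<open>The terms with \<open>m = l\<close> of the double minimum are the terms of the single
  one.\<close>

lemma F_EH_le_F'_EH:
  assumes K: "K \<ge> 2" and p: "p \<in> cube K"
  shows "F_EH K p \<le> F'_EH K p"
proof -
  have "(MIN l\<in>{1..K}. MIN m\<in>{1..l}.
           (real l * T K / real m + 1) * harmonic_mean (smallest_vec p l m))
      \<le> (T K + 1) * harmonic_mean (initial_vec p m)" if m: "m \<in> {1..K}" for m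
  proof -
    have "(real m * T K / real m + 1) * harmonic_mean (smallest_vec p m m) =
        (T K + 1) * harmonic_mean (initial_vec p m)"
      using m by (simp add: harmonic_mean_smallest_vec_full)
    moreover have "m \<in> {1..m}" using m by simp
    ultimately show ?thesis unfolding MIN_MIN_le_iff[OF K] using m by (metis order_refl)
  qed
  thus ?thesis
    using K unfolding F_EH_eq_Min[OF K p] F'_EH_eq_Min[OF K p]
    by (intro min.mono) (auto simp: le_MIN_iff)
qed

lemma F'_EH_le_F'_H:
  assumes K: "K \<ge> 2" and p: "p \<in> cube K"
  shows "F'_EH K p \<le> F'_H K p"
  unfolding F'_EH_eq_Min[OF K p] F'_H_def
  using K by (intro min.coboundedI2 Min_le) auto

lemma harmonic_mean_initial_vec_mono:
  assumes "p \<in> cube K" and "q \<in> cube K" and "\<forall>i\<in>{1..K}. p i \<le> q i" and m: "m \<in> {1..K}"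
  shows "harmonic_mean (initial_vec p m) \<le> harmonic_mean (initial_vec q m)"
proof (cases "\<exists>i\<in>{1..m}. p i = 0")
  case True
  moreover have "0 \<le> harmonic_mean (initial_vec q m)"
    using cube_bounds[OF assms(2)] m by (intro harmonic_mean_nonneg) (auto simp: set_initial_vec)
  ultimately show ?thesis by (simp add: harmonic_mean_initial_vec)
next
  case False
  have p0: "0 < p i" "p i \<le> q i" if "i \<in> {1..m}" for i
    using that False cube_bounds[OF assms(1), of i] assms(3) m by (auto simp: less_le)
  hence "\<not> (\<exists>i\<in>{1..m}. q i = 0)" by force
  moreover have "inverse (\<Sum>i=1..m. 1 / p i) \<le> inverse (\<Sum>i=1..m. 1 / q i)"
  proof (rule le_imp_inverse_le)
    have q0: "0 < q i" if "i \<in> {1..m}" for i using p0[OF that] by linarith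
    show "(\<Sum>i=1..m. 1 / q i) \<le> (\<Sum>i=1..m. 1 / p i)"
      using p0 q0 by (intro sum_mono divide_left_mono) auto
    show "0 < (\<Sum>i=1..m. 1 / q i)" using q0 m by (intro sum_pos) auto
  qed
  ultimately show ?thesis using False by (simp add: harmonic_mean_initial_vec mult_left_mono)
qed

section \<open>Measurability on the cube\<close>

lemma borel_measurable_component_cube:
  "i \<in> {1..K} \<Longrightarrow> (\<lambda>p. p i :: real) \<in> borel_measurable (restrict_space (\<Pi>\<^sub>M i\<in>{1..K}. borel) (cube K))"
  by (intro measurable_restrict_space1 measurable_component_singleton)

lemma borel_measurable_harmonic_mean_initial_vec:
  assumes "m \<in> {1..K}"
  shows "(\<lambda>p. harmonic_mean (initial_vec p m))
    \<in> borel_measurable (restrict_space (\<Pi>\<^sub>M i\<in>{1..K}. borel) (cube K))" (is "_ \<in> borel_measurable ?N")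
proof -
  have c [measurable]: "(\<lambda>p. p i) \<in> borel_measurable ?N" if "i \<in> {1..m}" for i
    using borel_measurable_component_cube[of i K] that assms by simp
  have "Measurable.pred ?N (\<lambda>p. p i = 0)" if "i \<in> {1..m}" for i
    using c[OF that] by measurable
  hence "Measurable.pred ?N (\<lambda>p. \<exists>i\<in>{1..m}. p i = 0)"
    by (intro pred_intros_finite) auto
  moreover have "(\<lambda>p. real m * inverse (\<Sum>i=1..m. 1 / p i)) \<in> borel_measurable ?N"
    by (intro borel_measurable_times borel_measurable_inverse borel_measurable_sum
        borel_measurable_divide c) auto
  ultimately show ?thesis
    unfolding harmonic_mean_initial_vec by (intro measurable_If) auto
qed

text \<open>Sublevel sets at levels in the open unit interval are given by finitely many sums of
  \<open>calib\<close>, which bypasses the sorted vectors of the closed form.\<close>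

lemma borel_measurable_F_EH:
  assumes K: "K \<ge> 2"
  shows "F_EH K \<in> borel_measurable (restrict_space (\<Pi>\<^sub>M i\<in>{1..K}. borel) (cube K))"
    (is "_ \<in> borel_measurable ?N")
proof -
  have sp: "space ?N = cube K" by (auto simp: space_restrict_space space_PiM cube_def)
  have c: "(\<lambda>p. calib K \<alpha> (p i)) \<in> borel_measurable ?N" if "i \<in> {1..K}" for i \<alpha>
    using measurable_compose[OF borel_measurable_component_cube[OF that] borel_measurable_calib] .
  have lev: "{p\<in>space ?N. F_EH K p \<le> \<alpha>} \<in> sets ?N" if \<alpha>: "0 < \<alpha>" "\<alpha> < 1" for \<alpha>
  proof -
    have "(\<lambda>p. \<Sum>i=1..l. calib K \<alpha> (p i)) \<in> borel_measurable ?N" if "l \<in> {1..K}" for l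
      using that by (intro borel_measurable_sum c) auto
    hence "Measurable.pred ?N (\<lambda>p. \<exists>l\<in>{1..K}. real l \<le> (\<Sum>i=1..l. calib K \<alpha> (p i)))"
      by (intro pred_intros_finite) (auto intro: borel_measurable_le)
    moreover have "{p\<in>space ?N. F_EH K p \<le> \<alpha>} =
        {p\<in>space ?N. \<exists>l\<in>{1..K}. real l \<le> (\<Sum>i=1..l. calib K \<alpha> (p i))}"
      using F_EH_le_iff[OF K _ \<alpha>] sp by auto
    ultimately show ?thesis by simp
  qed
  show ?thesis
    unfolding borel_measurable_iff_less
  proof
    fix a :: real
    consider "a \<le> 0" | "1 < a" | "0 < a" "a \<le> 1" by linarith
    thus "{p\<in>space ?N. F_EH K p < a} \<in> sets ?N"
    proof cases
      case 1
      hence "{p\<in>space ?N. F_EH K p < a} = {}" using F_EH_bounds[OF K] sp by force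
      thus ?thesis by (simp only: sets.empty_sets)
    next
      case 2
      hence "{p\<in>space ?N. F_EH K p < a} = space ?N" using F_EH_bounds[OF K] sp by force
      thus ?thesis by (simp only: sets.top)
    next
      case 3
      \<comment> \<open>Rational levels in \<open>(0,a)\<close> lie in \<open>(0,1)\<close>, where
        \<open>lev\<close> applies; a rational above \<open>F_EH K p\<close> is positive since
        \<open>F_EH K p \<ge> 0\<close>.\<close>
      have "{p\<in>space ?N. F_EH K p < a} =
          (\<Union>\<alpha>\<in>\<rat> \<inter> {0<..<a}. {p\<in>space ?N. F_EH K p \<le> \<alpha>})"
      proof (intro equalityI subsetI)
        fix p assume p: "p \<in> {p\<in>space ?N. F_EH K p < a}"
        then obtain \<alpha> where "\<alpha> \<in> \<rat>" "F_EH K p < \<alpha>" "\<alpha> < a"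
          using Rats_dense_in_real by blast
        moreover have "0 \<le> F_EH K p" using p F_EH_bounds[OF K] sp by blast
        ultimately show "p \<in> (\<Union>\<alpha>\<in>\<rat> \<inter> {0<..<a}. {p\<in>space ?N. F_EH K p \<le> \<alpha>})"
          using p by (intro UN_I[of \<alpha>]) auto
      qed auto
      also have "\<dots> \<in> sets ?N"
        using 3 lev countable_rat by (intro sets.countable_UN') auto
      finally show ?thesis .
    qed
  qed
qed

section \<open>Probability bound for exchangeable vectors\<close>

text \<open>For every \<open>F\<close> above \<open>F_EH\<close> the event lies inside the
  measurable event on the sums of \<open>calib\<close>, so one bound serves all three
  functions.\<close>

lemma (in prob_space) prob_F_EH_le:
  assumes K: "K \<ge> 2" and dom: "\<And>p. p \<in> cube K \<Longrightarrow> F_EH K p \<le> F p"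
    and P: "P \<in> uniform_vectors M K" "exchangeable M K P" and \<alpha>: "\<alpha> \<in> {0<..<1}"
  shows "prob {\<omega>\<in>space M. P \<omega> \<in> cube K \<and> F (P \<omega>) \<le> \<alpha>} \<le> \<alpha>"
proof -
  have \<alpha>': "0 < \<alpha>" "\<alpha> < 1" using \<alpha> by auto
  let ?B = "{\<omega>\<in>space M. \<exists>l\<in>{1..K}. real l \<le> (\<Sum>i=1..l. calib K \<alpha> (P \<omega> i))}"
  have Pm: "P \<in> M \<rightarrow>\<^sub>M (\<Pi>\<^sub>M i\<in>{1..K}. borel)" using P by (simp add: uniform_vectors_def)
  have "(\<lambda>\<omega>. calib K \<alpha> (P \<omega> i)) \<in> borel_measurable M" if "i \<in> {1..K}" for i
    using measurable_compose[OF measurable_compose[OF Pm measurable_component_singleton[OF that]]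
        borel_measurable_calib] .
  hence "(\<lambda>\<omega>. \<Sum>i=1..l. calib K \<alpha> (P \<omega> i)) \<in> borel_measurable M" if "l \<in> {1..K}" for l
    using that by (intro borel_measurable_sum) auto
  hence "Measurable.pred M (\<lambda>\<omega>. \<exists>l\<in>{1..K}. real l \<le> (\<Sum>i=1..l. calib K \<alpha> (P \<omega> i)))"
    by (intro pred_intros_finite) (auto intro: borel_measurable_le)
  hence "?B \<in> events" by simp
  moreover have "{\<omega>\<in>space M. P \<omega> \<in> cube K \<and> F (P \<omega>) \<le> \<alpha>} \<subseteq> ?B"
    using dom F_EH_le_iff[OF K _ \<alpha>'] order_trans by blast
  ultimately have "prob {\<omega>\<in>space M. P \<omega> \<in> cube K \<and> F (P \<omega>) \<le> \<alpha>} \<le> prob ?B"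
    by (intro finite_measure_mono) auto
  also have "\<dots> \<le> \<alpha>" by (rule prob_calib_average_ge_1_le[OF K \<alpha>' P])
  finally show ?thesis .
qed

section \<open>Strictness of the dominations\<close>

text \<open>At the vector of ones \<open>F'_H\<close> equals \<open>T K + 1 > 1\<close>, while
  \<open>F'_EH\<close> is capped at 1.\<close>

lemma strictly_dominates_F'_EH_F'_H:
  assumes K: "K \<ge> 2"
  shows "strictly_dominates K (F'_EH K) (F'_H K)"
proof -
  define p where "p = (\<lambda>i\<in>{1..K}. 1 :: real)"
  have p: "p \<in> cube K" by (auto simp: p_def cube_def)
  have "harmonic_mean (initial_vec p K) = 1"
    using K by (simp add: harmonic_mean_initial_vec p_def)
  hence "F'_EH K p < F'_H K p"
    using T_gt_1[OF K] by (simp add: F'_EH_eq_Min[OF K p] F'_H_def)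
  thus ?thesis using F'_EH_le_F'_H[OF K] p by (auto simp: strictly_dominates_def)
qed

text \<open>A small second entry after a first entry 1 can be used alone by \<open>F_EH\<close>,
  through \<open>l = 2\<close> and \<open>m = 1\<close>, whereas \<open>F'_EH\<close> must include
  the first entry. The value 1/2 separates the two.\<close>

lemma strictly_dominates_F_EH_F'_EH:
  assumes K: "K \<ge> 2"
  shows "strictly_dominates K (F_EH K) (F'_EH K)"
proof -
  define t where "t = T K"
  have t: "t > 1" using T_gt_1[OF K] by (simp add: t_def)
  \<comment> \<open>The choice makes \<open>(2 * t + 1) * a = 1/2\<close>.\<close>
  define a where "a = 1 / (4 * t + 2)"
  define p where "p = (\<lambda>i\<in>{1..K}. if i = 2 then a else 1)"
  have a: "0 < a" "a < 1" using t by (auto simp: a_def)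
  have p: "p \<in> cube K" using a by (auto simp: p_def cube_def)
  have "smallest_vec p 2 1 = [a]"
    using K a by (simp add: smallest_vec_def initial_vec_def p_def numeral_2_eq_2)
  hence "(real 2 * t / real 1 + 1) * harmonic_mean (smallest_vec p 2 1) = 1 / 2"
    using a t by (simp add: harmonic_mean_def a_def field_simps)
  hence "(MIN l\<in>{1..K}. MIN m\<in>{1..l}.
           (real l * t / real m + 1) * harmonic_mean (smallest_vec p l m)) \<le> 1 / 2"
    unfolding MIN_MIN_le_iff[OF K] using K by (intro bexI[of _ 2] bexI[of _ 1]) auto
  hence "F_EH K p \<le> 1 / 2" by (simp add: F_EH_eq_Min[OF K p] t_def min.coboundedI2)
  moreover have "(t + 1) * harmonic_mean (initial_vec p m) > 1 / 2" if m: "m \<in> {1..K}" for m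
  proof (cases "m = 1")
    case True
    hence "harmonic_mean (initial_vec p m) = 1"
      using K by (simp add: harmonic_mean_initial_vec p_def)
    thus ?thesis using t by simp
  next
    case False
    hence m2: "2 \<in> {1..m}" using m by auto
    have "(\<Sum>i=1..m. 1 / p i) = 1 / p 2 + (\<Sum>i\<in>{1..m} - {2}. 1 / p i)"
      using m2 by (intro sum.remove) auto
    also have "(\<Sum>i\<in>{1..m} - {2}. 1 / p i) = (\<Sum>i\<in>{1..m} - {2}. 1)"
      using m by (intro sum.cong) (auto simp: p_def)
    also have "\<dots> = real m - 1" using m2 m by (simp add: of_nat_diff)
    \<comment> \<open>The second entry contributes \<open>4 * t + 2\<close>, the other
      \<open>m - 1\<close> entries contribute 1 each.\<close>
    finally have s: "(\<Sum>i=1..m. 1 / p i) = 4 * t + 1 + real m"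
      using K t by (simp add: p_def a_def)
    have "\<not> (\<exists>i\<in>{1..m}. p i = 0)" using a m by (auto simp: p_def)
    hence hm: "harmonic_mean (initial_vec p m) = real m / (4 * t + 1 + real m)"
      unfolding harmonic_mean_initial_vec s by (simp add: divide_inverse)
    \<comment> \<open>Cleared of denominators, the claim reads
      \<open>4 * t + 1 < 2 * t * m + m\<close>, which holds for all
      \<open>m \<ge> 2\<close>.\<close>
    have "t * real m \<ge> t * 2" using m2 t by (intro mult_left_mono) auto
    moreover have "real m \<ge> 2" using m2 by simp
    ultimately have "1 + t * 4 < real m + t * (real m * 2)" by linarith
    thus ?thesis using t by (simp add: hm field_simps)
  qed
  hence "1 / 2 < (MIN m\<in>{1..K}. (t + 1) * harmonic_mean (initial_vec p m))"
    using K by (subst Min_gr_iff) auto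
  hence "F'_EH K p > 1 / 2" unfolding F'_EH_eq_Min[OF K p] t_def by simp
  ultimately have "F_EH K p < F'_EH K p" by linarith
  thus ?thesis using F_EH_le_F'_EH[OF K] p by (auto simp: strictly_dominates_def)
qed

section \<open>Measurability and monotonicity of \<open>F'_EH\<close> from its closed form\<close>

lemma borel_measurable_F'_EH:
  assumes K: "K \<ge> 2"
  shows "F'_EH K \<in> borel_measurable (restrict_space (\<Pi>\<^sub>M i\<in>{1..K}. borel) (cube K))"
    (is "_ \<in> borel_measurable ?N")
proof -
  have "(\<lambda>p. min 1 (MIN m\<in>{1..K}. (T K + 1) * harmonic_mean (initial_vec p m))) \<in> borel_measurable ?N"
    by (intro borel_measurable_min borel_measurable_Min borel_measurable_times
        borel_measurable_harmonic_mean_initial_vec) auto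
  moreover have "F'_EH K p = min 1 (MIN m\<in>{1..K}. (T K + 1) * harmonic_mean (initial_vec p m))"
    if "p \<in> space ?N" for p
    using that by (intro F'_EH_eq_Min[OF K]) (simp add: space_restrict_space)
  ultimately show ?thesis by (subst measurable_cong) auto
qed

lemma F'_EH_mono:
  assumes K: "K \<ge> 2" and p: "p \<in> cube K" and q: "q \<in> cube K" and le: "\<forall>i\<in>{1..K}. p i \<le> q i"
  shows "F'_EH K p \<le> F'_EH K q"
proof -
  have "(MIN m\<in>{1..K}. (T K + 1) * harmonic_mean (initial_vec p m)) \<le>
      (T K + 1) * harmonic_mean (initial_vec q m)" if m: "m \<in> {1..K}" for m
  proof -
    have "(T K + 1) * harmonic_mean (initial_vec p m) \<le> (T K + 1) * harmonic_mean (initial_vec q m)"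
      using harmonic_mean_initial_vec_mono[OF p q le m] T_gt_1[OF K] by (intro mult_left_mono) auto
    thus ?thesis using m K by (subst MIN_le_iff) auto
  qed
  thus ?thesis
    using K unfolding F'_EH_eq_Min[OF K p] F'_EH_eq_Min[OF K q]
    by (intro min.mono) (auto simp: le_MIN_iff)
qed

theorem theorem7p3:
  fixes M :: "'a measure" and K :: nat
  assumes "prob_space M" and "atomless M" and "K \<ge> 2"
  shows "ex_p_merging M K (F_EH K) \<and>
    ex_p_merging M K (F'_EH K) \<and>
    ex_p_merging M K (F'_H K) \<and>
    strictly_dominates K (F_EH K) (F'_EH K) \<and>
    strictly_dominates K (F'_EH K) (F'_H K) \<and>
    (\<forall>p\<in>cube K.
       F'_EH K p =
         min 1 (MIN m\<in>{1..K}. (T K + 1) * harmonic_mean (initial_vec p m)) \<and>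
       F_EH K p =
         min 1 (MIN l\<in>{1..K}. MIN m\<in>{1..l}.
           (real l * T K / real m + 1) * harmonic_mean (smallest_vec p l m)))"
proof -
  note K = \<open>K \<ge> 2\<close>
  interpret prob_space M by fact
  \<comment> \<open>Being above \<open>F_EH\<close>, the two other functions inherit both its
    nonnegativity and its probability bound.\<close>
  have dom': "F_EH K p \<le> F'_EH K p" and dom: "F_EH K p \<le> F'_H K p" if "p \<in> cube K" for p
    using F_EH_le_F'_EH[OF K that] F'_EH_le_F'_H[OF K that] by linarith+
  have "ex_p_merging M K (F_EH K)"
    unfolding ex_p_merging_def
    using borel_measurable_F_EH[OF K] F_EH_bounds(1)[OF K] F_EH_mono[OF K]
      prob_F_EH_le[OF K order_refl] by blast
  moreover have "ex_p_merging M K (F'_EH K)"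
    unfolding ex_p_merging_def
    using borel_measurable_F'_EH[OF K] order_trans[OF F_EH_bounds(1)[OF K] dom'] F'_EH_mono[OF K]
      prob_F_EH_le[OF K dom'] by blast
  moreover have "F'_H K \<in> borel_measurable (restrict_space (\<Pi>\<^sub>M i\<in>{1..K}. borel) (cube K))"
    unfolding F'_H_def using K
    by (intro borel_measurable_times borel_measurable_harmonic_mean_initial_vec) auto
  moreover have "F'_H K p \<le> F'_H K q"
    if "p \<in> cube K" "q \<in> cube K" "\<forall>i\<in>{1..K}. p i \<le> q i" for p q
    unfolding F'_H_def using harmonic_mean_initial_vec_mono[OF that, of K] T_gt_1[OF K] K
    by (intro mult_left_mono) auto
  ultimately show ?thesis
    unfolding ex_p_merging_def[of M K "F'_H K"]
    using order_trans[OF F_EH_bounds(1)[OF K] dom] prob_F_EH_le[OF K dom]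
      strictly_dominates_F_EH_F'_EH[OF K] strictly_dominates_F'_EH_F'_H[OF K]
      F_EH_eq_Min[OF K] F'_EH_eq_Min[OF K] by blast
qed

end
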